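(* Let $t, r, s$ be integers with $1 \leq t \leq r \leq s$, and let \[c(r,s,t) = r + (s-t)\max \left\{2{s \choose t}, \; 2^r(r-t){r \choose t} + 1 \right\}.\] Let $\mathcal{H}$ be a hereditary family with $\mu(\mathcal{H}) \geq c(r,s,t)$. Suppose $\mathcal{A} \subseteq \mathcal{H}^{(r)}$ and $\mathcal{B} \subseteq \mathcal{H}^{(s)}$ (possibly empty) are cross-$t$-intersecting and $|\mathcal{A}| + |\mathcal{B}|$ is maximum among all pairs of (possibly empty) cross-$t$-intersecting families $\mathcal{A}' \subseteq \mathcal{H}^{(r)}$, $\mathcal{B}' \subseteq \mathcal{H}^{(s)}$. Then $(\mathcal{A},\mathcal{B}) = (\emptyset,\mathcal{H}^{(s)})$, or $r = s$ and $(\mathcal{A},\mathcal{B}) = (\mathcal{H}^{(r)},\emptyset)$.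
   Context: All sets and families (sets of sets) are finite. A family $\mathcal{H}$ is hereditary if for every $A \in \mathcal{H}$, every subset of $A$ is in $\mathcal{H}$. For a family $\mathcal{F}$, $\mathcal{F}^{(r)}$ denotes the family of $r$-element sets in $\mathcal{F}$. A set $B \in \mathcal{F}$ is a base of $\mathcal{F}$ if $B$ is not a proper subset of any $A \in \mathcal{F}$; $\mu(\mathcal{F})$ is the size of a smallest base of $\mathcal{F}$. Families $\mathcal{A}, \mathcal{B}$ are cross-$t$-intersecting if $|A \cap B| \geq t$ for all $A \in \mathcal{A}$, $B \in \mathcal{B}$ (this holds vacuously if one of them is empty).
   Formalization: The formal version excludes r = s = t with H having exactly one or two t-element sets; there the claim is false, since for a t-set X in H the pair ({X},{X}) is a maximum cross-t-intersecting pair with both families nonempty. *)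

theory Defs
  imports Complex_Main
begin

definition hereditary :: "'a set set \<Rightarrow> bool" where
  "hereditary H \<longleftrightarrow> (\<forall>A\<in>H. \<forall>B. B \<subseteq> A \<longrightarrow> B \<in> H)"

definition level :: "'a set set \<Rightarrow> nat \<Rightarrow> 'a set set" where
  "level F r = {A \<in> F. card A = r}"

definition bases :: "'a set set \<Rightarrow> 'a set set" where
  "bases F = {B \<in> F. \<not> (\<exists>A\<in>F. B \<subset> A)}"

(* Only meaningful for finite, nonempty F: such an F has a base, whereas the
   minimum over the empty set is an unspecified number. *)
definition mu :: "'a set set \<Rightarrow> nat" where
  "mu F = Min (card ` bases F)"

definition cross_intersecting :: "nat \<Rightarrow> 'a set set \<Rightarrow> 'a set set \<Rightarrow> bool" where
  "cross_intersecting t \<A> \<B> \<longleftrightarrow> (\<forall>A\<in>\<A>. \<forall>B\<in>\<B>. t \<le> card (A \<inter> B))"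

(* Used only for t \<le> r \<le> s, so the natural-number subtractions are never truncated. *)
definition c :: "nat \<Rightarrow> nat \<Rightarrow> nat \<Rightarrow> nat" where
  "c r s t = r + (s - t) * max (2 * (s choose t)) (2 ^ r * (r - t) * (r choose t) + 1)"

definition max_cross_pair ::
  "'a set set \<Rightarrow> nat \<Rightarrow> nat \<Rightarrow> nat \<Rightarrow> 'a set set \<Rightarrow> 'a set set \<Rightarrow> bool" where
  "max_cross_pair H r s t \<A> \<B> \<longleftrightarrow>
     \<A> \<subseteq> level H r \<and> \<B> \<subseteq> level H s \<and> cross_intersecting t \<A> \<B> \<and>
     (\<forall>\<A>' \<B>'. \<A>' \<subseteq> level H r \<and> \<B>' \<subseteq> level H s \<and> cross_intersecting t \<A>' \<B>' \<longrightarrow>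
        card \<A>' + card \<B>' \<le> card \<A> + card \<B>)"

(* For r = s = t the constant c is just r, and a single set X of size t gives the
   cross-t-intersecting pair ({X}, {X}), of total size 2. If H has only one or two sets
   of size t, this pair is maximum, so that case has to be excluded when one claims that
   maximum pairs have an empty component. *)
lemma max_cross_pair_degenerate:
  assumes "finite H" and finX: "\<And>X. X \<in> H \<Longrightarrow> finite X"
    and two: "card (level H t) \<in> {1, 2}"
  shows "\<exists>X \<in> level H t. max_cross_pair H t t t {X} {X}"
proof -
  have fin: "finite (level H t)"
    using assms(1) by (simp add: level_def)
  obtain X where X: "X \<in> level H t"
    using two by fastforce
  have bound: "card \<A> + card \<B> \<le> 2"
    if AB: "\<A> \<subseteq> level H t" "\<B> \<subseteq> level H t" "cross_intersecting t \<A> \<B>" for \<A> \<B>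
  proof (cases "\<A> = {} \<or> \<B> = {}")
    case True
    moreover have "card \<A> \<le> card (level H t)" "card \<B> \<le> card (level H t)"
      using AB fin by (auto intro: card_mono)
    ultimately show ?thesis using two by auto
  next
    case False
    have eq: "A = B" if "A \<in> \<A>" "B \<in> \<B>" for A B
    proof -
      have f: "finite A" "finite B" and k: "card A = t" "card B = t" "t \<le> card (A \<inter> B)"
        using that AB finX by (auto simp: level_def cross_intersecting_def)
      have "A \<inter> B = A" "A \<inter> B = B"
        using f k by (simp_all add: card_seteq)
      then show ?thesis by simp
    qed
    from False obtain A B where "A \<in> \<A>" "B \<in> \<B>" by blast
    then have "\<A> = {A}" "\<B> = {A}" using eq by blast+
    then show ?thesis by simp
  qed
  have "cross_intersecting t {X} {X}"
    using X by (simp add: cross_intersecting_def level_def)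
  moreover have "card {X} + card {X} = 2"
    by simp
  ultimately have "max_cross_pair H t t t {X} {X}"
    unfolding max_cross_pair_def using X bound by (auto simp: numeral_2_eq_2)
  then show ?thesis using X by blast
qed

end

theory Submission
  imports Defs
begin

text \<open>
  Write \<open>M = mu H\<close> and \<open>N\<close> for the number of \<open>s\<close>-sets in \<open>H\<close>, and let \<open>t < s\<close>. Every set of \<open>H\<close>
  lies in a base with at least \<open>M\<close> elements, so double counting gives two inequalities: replacing
  \<open>x\<close> by another element of a base shows that at most \<open>s N / M\<close> of the \<open>s\<close>-sets contain a
  given \<open>x\<close>; and adding an element shows that the number of \<open>i\<close>-sets containing a fixed \<open>t\<close>-set
  grows at least by the factor \<open>(M - i) / (i + 1 - t)\<close> from \<open>i\<close> to \<open>i + 1\<close>.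

  If \<open>\<A>\<close> and \<open>\<B>\<close> are both nonempty, every member of \<open>\<B>\<close> contains one of the \<open>r choose t\<close>
  \<open>t\<close>-subsets of a fixed member of \<open>\<A>\<close>, and \<open>M > 2 s (r choose t)\<close>, so \<open>\<B>\<close> has fewer than
  \<open>N / 2\<close> members. Likewise \<open>\<A>\<close> has at most \<open>N / 2\<close> members: by symmetry if \<open>r = s\<close>, and by
  \<open>M - r \<ge> 2 (s - t) (s choose t)\<close> and the growth inequality if \<open>r < s\<close>.
  So the pair is smaller than the pair with components \<open>{}\<close> and \<open>level H s\<close>.
\<close>

section \<open>Double counting, bases and \<open>t\<close>-intersections\<close>

lemma double_count_le:
  fixes R :: "'b \<Rightarrow> 'c \<Rightarrow> bool"
  assumes "finite A" "finite B"
    and "\<And>a. a \<in> A \<Longrightarrow> m \<le> card {b \<in> B. R a b}"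
    and "\<And>b. b \<in> B \<Longrightarrow> card {a \<in> A. R a b} \<le> k"
  shows "card A * m \<le> k * card B"
proof -
  have "card A * m \<le> (\<Sum>a\<in>A. card {b \<in> B. R a b})"
    using sum_bounded_below[of A m "\<lambda>a. card {b \<in> B. R a b}"] assms(3) by simp
  also have "\<dots> = (\<Sum>b\<in>B. card {a \<in> A. R a b})"
    using sum_multicount_gen[of A B R "\<lambda>b. card {a \<in> A. R a b}"] assms(1,2) by simp
  also have "\<dots> \<le> k * card B"
    using sum_bounded_above[of B "\<lambda>b. card {a \<in> A. R a b}" k] assms(4) by (simp add: mult.commute)
  finally show ?thesis .
qed

text \<open>A maximal member of \<open>H\<close> above \<open>X\<close> is a base, so
  \<open>mu H\<close> bounds its size from below.\<close>

lemma mu_le_card_base: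
  assumes "finite H" "X \<in> H"
  obtains Y where "Y \<in> H" "X \<subseteq> Y" "mu H \<le> card Y"
proof -
  obtain Y where Y: "Y \<in> H" "X \<subseteq> Y" "\<And>Z. Z \<in> H \<Longrightarrow> Y \<subseteq> Z \<Longrightarrow> Z = Y"
    using finite_has_maximal2[OF assms] by metis
  then have "Y \<in> bases H" by (auto simp: bases_def)
  moreover have "finite (bases H)" using assms(1) by (simp add: bases_def)
  ultimately have "mu H \<le> card Y" unfolding mu_def by simp
  with Y that show thesis by blast
qed

definition containing :: "'a set set \<Rightarrow> 'a set \<Rightarrow> 'a set set" where
  "containing F T = {A \<in> F. T \<subseteq> A}"

lemma containing_empty [simp]: "containing F {} = F"
  by (simp add: containing_def)

lemma finite_containing [simp]: "finite F \<Longrightarrow> finite (containing F T)"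
  by (simp add: containing_def)

lemma finite_level [simp]: "finite F \<Longrightarrow> finite (level F r)"
  by (simp add: level_def)

text \<open>Every member of \<open>F\<close> contains one of the \<open>t\<close>-subsets of
  \<open>B\<close>; the union bound charges \<open>K\<close> to each of these.\<close>

lemma card_t_intersecting_le:
  assumes "finite F" "finite B"
    and meets: "\<And>A. A \<in> F \<Longrightarrow> t \<le> card (A \<inter> B)"
    and K: "\<And>T. T \<subseteq> B \<Longrightarrow> card T = t \<Longrightarrow> card (containing F T) \<le> K"
  shows "card F \<le> (card B choose t) * K"
proof -
  let ?T = "{T. T \<subseteq> B \<and> card T = t}"
  have fin: "finite ?T" using assms(2) by simp
  have "F \<subseteq> (\<Union>T\<in>?T. containing F T)"
  proof
    fix A assume A: "A \<in> F"
    obtain T where "T \<subseteq> A \<inter> B" "card T = t"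
      using obtain_subset_with_card_n[OF meets[OF A]] by blast
    with A show "A \<in> (\<Union>T\<in>?T. containing F T)" by (auto simp: containing_def)
  qed
  then have "card F \<le> card (\<Union>T\<in>?T. containing F T)"
    using assms(1) fin by (intro card_mono) auto
  also have "\<dots> \<le> (\<Sum>T\<in>?T. card (containing F T))"
    using fin by (rule card_UN_le)
  also have "\<dots> \<le> card ?T * K"
    using sum_bounded_above[of ?T "\<lambda>T. card (containing F T)" K] K by simp
  finally show ?thesis by (simp add: n_subsets[OF assms(2)])
qed

section \<open>Level sizes when every member lies in a large member\<close>

locale large_hereditary =
  fixes H :: "'a set set" and M :: nat
  assumes finite_H: "finite H"
    and finite_member: "X \<in> H \<Longrightarrow> finite X"
    and hereditary_H: "hereditary H"
    and ex_large: "X \<in> H \<Longrightarrow> \<exists>Y\<in>H. X \<subseteq> Y \<and> M \<le> card Y"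
begin

lemma subset_closed: "X \<in> H \<Longrightarrow> Y \<subseteq> X \<Longrightarrow> Y \<in> H"
  using hereditary_H by (auto simp: hereditary_def)

text \<open>Elements of \<open>Y - X\<close> can be added to \<open>X\<close>, or exchanged for
  elements of \<open>X\<close>, without leaving \<open>H\<close>. This supplies the lower degree
  bounds in both double counts.\<close>

lemma card_free_elements:
  assumes "X \<in> H" "card X = i"
  obtains Y where "Y \<in> H" "X \<subseteq> Y" "finite Y" "M - i \<le> card (Y - X)"
proof -
  obtain Y where Y: "Y \<in> H" "X \<subseteq> Y" "M \<le> card Y" using ex_large assms(1) by blast
  moreover have "card (Y - X) = card Y - i"
    using Y assms finite_member by (simp add: card_Diff_subset)
  ultimately show thesis using that finite_member by simp
qed

lemma level_nonempty:
  assumes "X \<in> H" "s \<le> M"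
  shows "level H s \<noteq> {}"
proof -
  obtain Y where Y: "Y \<in> H" "M \<le> card Y" using ex_large assms(1) by blast
  then obtain Z where "Z \<subseteq> Y" "card Z = s"
    using obtain_subset_with_card_n[of s Y] assms(2) by auto
  then show ?thesis using Y subset_closed by (auto simp: level_def)
qed

text \<open>Pairs \<open>X \<subseteq> Z\<close> are counted from both levels: \<open>X\<close> can
  be enlarged in at least \<open>M - i\<close> ways, while an element removed from \<open>Z\<close>
  must lie outside \<open>T\<close>.\<close>

lemma containing_level_step:
  assumes "finite T" "card T \<le> i"
  shows "card (containing (level H i) T) * (M - i)
       \<le> (i + 1 - card T) * card (containing (level H (Suc i)) T)"
proof (rule double_count_le[where R = "(\<subseteq>)"])
  fix X assume "X \<in> containing (level H i) T"
  then have X: "X \<in> H" "card X = i" "T \<subseteq> X" "finite X"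
    using finite_member by (auto simp: containing_def level_def)
  obtain Y where Y: "Y \<in> H" "X \<subseteq> Y" "finite Y" "M - i \<le> card (Y - X)"
    using card_free_elements X by blast
  have "inj_on (\<lambda>y. insert y X) (Y - X)"
    by (auto simp: inj_on_def)
  then have "card (Y - X) = card ((\<lambda>y. insert y X) ` (Y - X))"
    by (simp add: card_image)
  also have "\<dots> \<le> card {Z \<in> containing (level H (Suc i)) T. X \<subseteq> Z}"
    using X Y finite_H by (intro card_mono) (auto simp: containing_def level_def intro: subset_closed)
  finally show "M - i \<le> card {Z \<in> containing (level H (Suc i)) T. X \<subseteq> Z}"
    using Y by simp
next
  fix Z assume "Z \<in> containing (level H (Suc i)) T"
  then have Z: "card Z = Suc i" "T \<subseteq> Z" "finite Z"
    using finite_member by (auto simp: containing_def level_def)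
  have "{X \<in> containing (level H i) T. X \<subseteq> Z} \<subseteq> (\<lambda>z. Z - {z}) ` (Z - T)"
  proof
    fix X assume "X \<in> {X \<in> containing (level H i) T. X \<subseteq> Z}"
    then have X: "card X = i" "T \<subseteq> X" "X \<subseteq> Z" by (auto simp: containing_def level_def)
    then have "card (Z - X) = 1"
      using Z by (simp add: card_Diff_subset finite_subset)
    then obtain z where "Z - X = {z}" by (auto simp: card_1_singleton_iff)
    then have "X = Z - {z}" "z \<in> Z - T" using X by auto
    then show "X \<in> (\<lambda>z. Z - {z}) ` (Z - T)" by blast
  qed
  then have "card {X \<in> containing (level H i) T. X \<subseteq> Z} \<le> card (Z - T)"
    using Z by (intro surj_card_le) auto
  also have "\<dots> = i + 1 - card T" using Z assms by (simp add: card_Diff_subset)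
  finally show "card {X \<in> containing (level H i) T. X \<subseteq> Z} \<le> i + 1 - card T" .
qed (use finite_H in auto)

text \<open>As long as \<open>j < s\<close>, the bound \<open>2 * s \<le> M\<close> makes
  \<open>M - j\<close> at least \<open>j + 1 - card T\<close>, so no step decreases the
  count.\<close>

lemma containing_level_mono:
  assumes "finite T" "card T \<le> i" "i \<le> s" "2 * s \<le> M"
  shows "card (containing (level H i) T) \<le> card (containing (level H s) T)"
  using assms(3,4)
proof (induction s rule: dec_induct)
  case (step j)
  have "card (containing (level H j) T) * (j + 1 - card T)
      \<le> card (containing (level H j) T) * (M - j)"
    using step.prems by (intro mult_left_mono) auto
  also have "\<dots> \<le> card (containing (level H (Suc j)) T) * (j + 1 - card T)"
    using containing_level_step[of T j] assms step.hyps by (simp add: mult.commute)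
  finally have "card (containing (level H j) T) \<le> card (containing (level H (Suc j)) T)"
    using assms(2) step.hyps by simp
  with step show ?case by simp
qed simp

text \<open>Only the step from \<open>r\<close> to \<open>r + 1\<close> is used at full strength;
  beyond it monotonicity suffices, and \<open>r + 1 - card T\<close> is relaxed to
  \<open>s - card T\<close>.\<close>

lemma containing_level_growth:
  assumes "finite T" "card T \<le> r" "r < s" "2 * s \<le> M"
  shows "card (containing (level H r) T) * (M - r) \<le> (s - card T) * card (containing (level H s) T)"
proof -
  have "card (containing (level H r) T) * (M - r)
      \<le> (r + 1 - card T) * card (containing (level H (Suc r)) T)"
    using assms by (intro containing_level_step)
  also have "\<dots> \<le> (s - card T) * card (containing (level H s) T)"
    using assms by (intro mult_mono containing_level_mono) auto
  finally show ?thesis .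
qed

text \<open>With \<open>T = {}\<close> the growth factor is \<open>(M - r) / s\<close>, which
  exceeds 1. This rules out an empty second component when \<open>r < s\<close>.\<close>

lemma card_level_less:
  assumes "r < s" "2 * s \<le> M" "H \<noteq> {}"
  shows "card (level H r) < card (level H s)"
proof -
  obtain X where "X \<in> H" using assms(3) by blast
  then have "level H s \<noteq> {}" using level_nonempty assms(2) by force
  then have pos: "0 < card (level H s)" using finite_H by (simp add: card_gt_0_iff)
  have "card (level H r) * (M - r) \<le> s * card (level H s)"
    using containing_level_growth[of "{}" r s] assms by simp
  also have "\<dots> < (M - r) * card (level H s)"
    using pos assms by (intro mult_strict_right_mono) auto
  finally show ?thesis by (simp add: mult.commute)
qed

lemma card_containing_element:
  assumes "s \<le> M"
  shows "card (containing (level H s) {x}) * M \<le> s * card (level H s)"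
proof -
  let ?P = "containing (level H s) {x}" and ?Q = "{Z \<in> level H s. x \<notin> Z}"
  have "card ?P * (M - s) \<le> s * card ?Q"
  \<comment> \<open>\<open>Z\<close> arises from \<open>X\<close> by exchanging \<open>x\<close> for
    another element: \<open>X\<close> has at least \<open>M - s\<close> partners, \<open>Z\<close>
    at most \<open>s\<close>.\<close>
  proof (rule double_count_le[where R = "\<lambda>X Z. X - {x} \<subseteq> Z"])
    fix X assume "X \<in> ?P"
    then have X: "X \<in> H" "card X = s" "x \<in> X" "finite X"
      using finite_member by (auto simp: containing_def level_def)
    obtain Y where Y: "Y \<in> H" "X \<subseteq> Y" "finite Y" "M - s \<le> card (Y - X)"
      using card_free_elements X by blast
    let ?f = "\<lambda>y. insert y (X - {x})"
    have "inj_on ?f (Y - X)"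
      by (auto simp: inj_on_def)
    then have "card (Y - X) = card (?f ` (Y - X))"
      by (simp add: card_image)
    also have "\<dots> \<le> card {Z \<in> ?Q. X - {x} \<subseteq> Z}"
    proof (intro card_mono subsetI)
      fix Z assume "Z \<in> ?f ` (Y - X)"
      then obtain y where y: "y \<in> Y - X" "Z = ?f y" by blast
      have "card Z = s"
        using X y card_Suc_Diff1[of X x] by simp
      moreover have "Z \<in> H"
        using X Y y by (intro subset_closed[OF Y(1)]) auto
      ultimately show "Z \<in> {Z \<in> ?Q. X - {x} \<subseteq> Z}"
        using X y by (auto simp: level_def)
    qed (use finite_H in auto)
    finally show "M - s \<le> card {Z \<in> ?Q. X - {x} \<subseteq> Z}" using Y by simp
  next
    fix Z assume "Z \<in> ?Q"
    then have Z: "card Z = s" "x \<notin> Z" "finite Z"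
      using finite_member by (auto simp: level_def)
    have "{X \<in> ?P. X - {x} \<subseteq> Z} \<subseteq> (\<lambda>z. insert x (Z - {z})) ` Z"
    proof
      fix X assume "X \<in> {X \<in> ?P. X - {x} \<subseteq> Z}"
      then have X: "card X = s" "x \<in> X" "X - {x} \<subseteq> Z" "finite X"
        using finite_member by (auto simp: containing_def level_def)
      have "card (X - {x}) + 1 = s" using X card_Suc_Diff1[of X x] by simp
      then have "card (Z - (X - {x})) = 1"
        using Z X by (simp add: card_Diff_subset)
      then obtain z where "Z - (X - {x}) = {z}" by (auto simp: card_1_singleton_iff)
      then have "X = insert x (Z - {z})" "z \<in> Z" using X Z by auto
      then show "X \<in> (\<lambda>z. insert x (Z - {z})) ` Z" by blast
    qed
    then show "card {X \<in> ?P. X - {x} \<subseteq> Z} \<le> s"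
      using surj_card_le[OF Z(3)] Z(1) by simp
  qed (use finite_H in auto)
  moreover have split: "card ?P + card ?Q = card (level H s)"
  proof -
    have "?P \<union> ?Q = level H s" "?P \<inter> ?Q = {}" by (auto simp: containing_def)
    then show ?thesis using card_Un_disjoint[of ?P ?Q] finite_H by simp
  qed
  \<comment> \<open>Adding \<open>s * card ?P\<close> to both sides of the count turns
    \<open>M - s\<close> into \<open>M\<close> and \<open>card ?Q\<close> into
    \<open>card (level H s)\<close>.\<close>
  moreover have "card ?P * M = card ?P * (M - s) + card ?P * s"
    using assms by (simp flip: distrib_left)
  moreover have "s * card (level H s) = s * card ?Q + card ?P * s"
    by (simp flip: split add: distrib_left)
  ultimately show ?thesis by linarith
qed

lemma card_t_intersecting_half:
  assumes "1 \<le> t" "s \<le> M" "2 * s * (card A choose t) < M" "finite A" "H \<noteq> {}"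
    and "F \<subseteq> level H s" "\<And>X. X \<in> F \<Longrightarrow> t \<le> card (X \<inter> A)"
  shows "2 * card F < card (level H s)"
proof -
  obtain X where "X \<in> H" using assms(5) by blast
  then have "level H s \<noteq> {}" using level_nonempty assms(2) by blast
  then have pos: "0 < card (level H s)" using finite_H by (simp add: card_gt_0_iff)
  have fin: "finite F" using assms(6) finite_H finite_subset by fastforce
  \<comment> \<open>The bound for each \<open>T\<close> has to be a natural number, hence
    \<open>div\<close>; it rounds down, so multiplying by \<open>M\<close> again cannot
    overshoot.\<close>
  have "card F \<le> (card A choose t) * (s * card (level H s) div M)"
  proof (rule card_t_intersecting_le[OF fin assms(4,7)])
    fix T assume "T \<subseteq> A" "card T = t"
    \<comment> \<open>As \<open>t \<ge> 1\<close>, the sets containing \<open>T\<close> are among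
      those through a single element.\<close>
    then obtain x where "x \<in> T" using assms(1) by fastforce
    then have "containing F T \<subseteq> containing (level H s) {x}"
      using assms(6) by (auto simp: containing_def)
    then have "card (containing F T) \<le> card (containing (level H s) {x})"
      using finite_H by (intro card_mono) auto
    also have "\<dots> \<le> s * card (level H s) div M"
      using card_containing_element[OF assms(2), of x] assms(3)
      by (simp add: less_eq_div_iff_mult_less_eq)
    finally show "card (containing F T) \<le> s * card (level H s) div M" .
  qed
  then have "2 * card F * M \<le> 2 * (card A choose t) * (s * card (level H s) div M * M)"
    by (simp add: mult.assoc)
  also have "\<dots> \<le> 2 * (card A choose t) * (s * card (level H s))"
    by (intro mult_le_mono2) simp
  also have "\<dots> = 2 * s * (card A choose t) * card (level H s)"
    by simp
  also have "\<dots> < M * card (level H s)"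
    using pos assms(3) by (intro mult_strict_right_mono) auto
  finally show ?thesis by (simp add: mult.commute)
qed

text \<open>By the growth inequality, with \<open>s - t\<close> cancelled, each of the
  \<open>s choose t\<close> subsets \<open>T\<close> of \<open>B\<close> accounts for at most
  \<open>card (level H s) / (2 * (s choose t))\<close> members of \<open>F\<close>.\<close>

lemma card_t_intersecting_half_lower:
  assumes "t \<le> r" "r < s" "2 * s \<le> M" "2 * (s - t) * (s choose t) \<le> M - r"
    and "B \<in> level H s" "F \<subseteq> level H r" "\<And>X. X \<in> F \<Longrightarrow> t \<le> card (X \<inter> B)"
  shows "2 * card F \<le> card (level H s)"
proof -
  have B: "finite B" "card B = s" using assms(5) finite_member by (auto simp: level_def)
  have pos: "0 < 2 * (s choose t)" using assms by (simp add: zero_less_binomial)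
  have fin: "finite F" using assms(6) finite_H finite_subset by fastforce
  have "card F \<le> (card B choose t) * (card (level H s) div (2 * (s choose t)))"
  proof (rule card_t_intersecting_le[OF fin B(1) assms(7)])
    fix T assume T: "T \<subseteq> B" "card T = t"
    then have finT: "finite T" using B finite_subset by blast
    have "(s - t) * (card (containing (level H r) T) * (2 * (s choose t)))
        \<le> card (containing (level H r) T) * (M - r)"
      using mult_le_mono2[OF assms(4), of "card (containing (level H r) T)"]
      by (simp add: ac_simps)
    also have "\<dots> \<le> (s - t) * card (containing (level H s) T)"
      using containing_level_growth[OF finT] T assms by simp
    also have "\<dots> \<le> (s - t) * card (level H s)"
      using finite_H by (intro mult_le_mono2 card_mono) (auto simp: containing_def)
    finally have "card (containing (level H r) T) * (2 * (s choose t)) \<le> card (level H s)"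
      using assms(1,2) by simp
    then have "card (containing (level H r) T) \<le> card (level H s) div (2 * (s choose t))"
      using pos by (simp add: less_eq_div_iff_mult_less_eq)
    moreover have "card (containing F T) \<le> card (containing (level H r) T)"
      using assms(6) finite_H by (intro card_mono) (auto simp: containing_def)
    ultimately show "card (containing F T) \<le> card (level H s) div (2 * (s choose t))"
      by simp
  qed
  then have "2 * card F \<le> (2 * (s choose t)) * (card (level H s) div (2 * (s choose t)))"
    using B by simp
  also have "\<dots> \<le> card (level H s)" by simp
  finally show ?thesis .
qed

end

section \<open>Arithmetic of the constant \<open>c\<close>\<close>

lemma le_diff_times_choose:
  fixes s t :: nat
  assumes "t < s"
  shows "s \<le> (s - t) * (s choose t)"
proof -
  \<comment> \<open>Absorption gives
    \<open>(s - t) * (s choose t) = s * ((s - 1) choose t)\<close>.\<close>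
  have "1 \<le> (s - 1) choose t" using assms by (simp add: Suc_le_eq zero_less_binomial)
  then show ?thesis by (simp add: binomial_absorb_comp)
qed

text \<open>The first entry of the maximum gives the first and third bounds. The second entry gives
  the second bound if \<open>t < r\<close>; for \<open>r = t\<close> it coincides with the first
  bound.\<close>

lemma c_gt:
  assumes "1 \<le> t" "t \<le> r" "r \<le> s" "t < s"
  shows "2 * s < c r s t" "2 * s * (r choose t) < c r s t" "2 * (s - t) * (s choose t) \<le> c r s t - r"
proof -
  have 1: "r + (s - t) * (2 * (s choose t)) \<le> c r s t"
    unfolding c_def by (intro add_left_mono mult_le_mono2) simp
  have 2: "r + (s - t) * (2 ^ r * (r - t) * (r choose t) + 1) \<le> c r s t"
    unfolding c_def by (intro add_left_mono mult_le_mono2) simp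
  show "2 * (s - t) * (s choose t) \<le> c r s t - r"
    using 1 by (simp add: ac_simps)
  have "2 * s \<le> (s - t) * (2 * (s choose t))"
    using le_diff_times_choose[OF assms(4)] by (simp add: ac_simps)
  then show 3: "2 * s < c r s t"
    using 1 assms by linarith
  show "2 * s * (r choose t) < c r s t"
  proof (cases "r = t")
    case True
    then show ?thesis using 3 by simp
  next
    case False
    \<comment> \<open>Here \<open>r \<ge> t + 1\<close> and \<open>s - t \<ge> 1\<close>, so
      \<open>(s - t) * r \<ge> (s - t) * t + (s - t) \<ge> s\<close>.\<close>
    have "s \<le> (s - t) * r"
    proof -
      have "(s - t) * (t + 1) \<le> (s - t) * r" using False assms by (intro mult_le_mono2) simp
      moreover have "t \<le> (s - t) * t" using assms by simp
      ultimately show ?thesis using assms by (simp add: algebra_simps)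
    qed
    moreover have "2 * r \<le> 2 ^ r * (r - t)"
    proof -
      have "r - 1 < 2 ^ (r - 1)" by simp
      then have "2 * r \<le> 2 * 2 ^ (r - 1)" by linarith
      also have "\<dots> = 2 ^ r" using assms by (simp flip: power_Suc)
      also have "\<dots> \<le> 2 ^ r * (r - t)" using False assms by simp
      finally show ?thesis .
    qed
    ultimately have "2 * s \<le> (s - t) * (2 ^ r * (r - t))"
      using mult_le_mono2[of "2 * r" "2 ^ r * (r - t)" "s - t"] by linarith
    then have "2 * s * (r choose t) \<le> (s - t) * (2 ^ r * (r - t)) * (r choose t)"
      by (rule mult_le_mono1)
    also have "\<dots> \<le> (s - t) * (2 ^ r * (r - t) * (r choose t) + 1)"
      by (simp add: algebra_simps)
    finally show ?thesis using 2 assms by linarith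
  qed
qed

section \<open>The degenerate case and the comparison of pairs\<close>

lemma cross_intersecting_degenerate:
  assumes "\<And>X. X \<in> H \<Longrightarrow> finite X" "\<A> \<subseteq> level H t" "\<B> \<subseteq> level H t"
    and "cross_intersecting t \<A> \<B>" "\<A> \<noteq> {}" "\<B> \<noteq> {}"
  shows "card \<A> + card \<B> = 2"
proof -
  have eq: "A = B" if "A \<in> \<A>" "B \<in> \<B>" for A B
  proof -
    have "finite A" "finite B" "card A = t" "card B = t" "t \<le> card (A \<inter> B)"
      using that assms by (auto simp: level_def cross_intersecting_def)
    then have "A \<inter> B = A" "A \<inter> B = B" by (simp_all add: card_seteq)
    then show ?thesis by simp
  qed
  obtain A B where "A \<in> \<A>" "B \<in> \<B>" using assms by blast
  then have "\<A> = {A}" "\<B> = {A}" using eq by blast+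
  then show ?thesis by simp
qed

theorem theorem1p12:
  fixes H \<A> \<B> :: "'a set set" and r s t :: nat
  assumes "1 \<le> t" and "t \<le> r" and "r \<le> s"
    and "finite H" and "\<And>X. X \<in> H \<Longrightarrow> finite X"
    and "hereditary H"
    and "mu H \<ge> c r s t"
    and "s = t \<Longrightarrow> card (level H s) \<notin> {1, 2}"
    and "max_cross_pair H r s t \<A> \<B>"
  shows "(\<A>, \<B>) = ({}, level H s) \<or> (r = s \<and> (\<A>, \<B>) = (level H r, {}))"
proof -
  have A: "\<A> \<subseteq> level H r" and B: "\<B> \<subseteq> level H s" and cross: "cross_intersecting t \<A> \<B>"
    and maximal: "\<And>\<A>' \<B>'. \<A>' \<subseteq> level H r \<Longrightarrow> \<B>' \<subseteq> level H s \<Longrightarrow>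
      cross_intersecting t \<A>' \<B>' \<Longrightarrow> card \<A>' + card \<B>' \<le> card \<A> + card \<B>"
    using assms(9) by (auto simp: max_cross_pair_def)
  have N_le: "card (level H s) \<le> card \<A> + card \<B>"
    using maximal[of "{}" "level H s"] by (simp add: cross_intersecting_def)
  \<comment> \<open>\<open>M\<close> is the lower bound \<open>c r s t\<close> rather than
    \<open>mu H\<close>; the extension property survives this weakening.\<close>
  interpret large_hereditary H "c r s t"
  proof
    fix X assume "X \<in> H"
    then show "\<exists>Y\<in>H. X \<subseteq> Y \<and> c r s t \<le> card Y"
      by (rule mu_le_card_base[OF assms(4)]) (use assms(7) in \<open>auto intro: order_trans\<close>)
  qed (use assms in auto)
  note gt = c_gt[OF assms(1-3)]
  consider "\<A> = {}" | "\<B> = {}" "r = s" | "\<A> \<noteq> {}" "\<B> = {}" "r < s" | "\<A> \<noteq> {}" "\<B> \<noteq> {}"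
    using assms(3) le_neq_implies_less by blast
  then show ?thesis
  proof cases
    case 1
    then have "\<B> = level H s" using B N_le assms(4) by (simp add: card_seteq)
    with 1 show ?thesis by simp
  next
    case 2
    then have "\<A> = level H r" using A N_le assms(4) by (simp add: card_seteq)
    with 2 show ?thesis by simp
  next
    case 3
    have "H \<noteq> {}" using 3 A by (auto simp: level_def)
    then have "card (level H r) < card (level H s)"
      using card_level_less 3 gt(1) assms(2) by simp
    moreover have "card \<A> \<le> card (level H r)" using A assms(4) by (simp add: card_mono)
    ultimately show ?thesis using N_le 3 by simp
  next
    case 4
    then obtain A0 B0 where A0: "A0 \<in> \<A>" and B0: "B0 \<in> \<B>" by blast
    have ne: "H \<noteq> {}" using A0 A by (auto simp: level_def)
    have A0': "finite A0" "card A0 = r" and B0': "finite B0" "card B0 = s"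
      using A0 A B0 B assms(5) by (auto simp: level_def)
    have meet_A0: "t \<le> card (X \<inter> A0)" if "X \<in> \<B>" for X
      using cross A0 that by (auto simp: cross_intersecting_def Int_commute)
    have meet_B0: "t \<le> card (X \<inter> B0)" if "X \<in> \<A>" for X
      using cross B0 that by (auto simp: cross_intersecting_def)
    show ?thesis
    proof (cases "t = s")
      case True
      then have "card \<A> + card \<B> = 2"
        using cross_intersecting_degenerate[of H \<A> t \<B>] assms(2,3,5) A B cross 4 by simp
      moreover have "card (level H s) \<noteq> 0" using B B0 assms(4) by auto
      \<comment> \<open>The level is nonempty and, by \<open>N_le\<close>, has at most 2 members,
        which is exactly the excluded case.\<close>
      ultimately show ?thesis using N_le assms(8) True by force
    next
      case False
      then have ts: "t < s" using assms by simp
      have "2 * card \<B> < card (level H s)"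
        using card_t_intersecting_half[of t s A0 \<B>] gt[OF ts] A0' ne B meet_A0 assms(1) by simp
      \<comment> \<open>A weak inequality suffices, since the bound on \<open>\<B>\<close> is
        strict. For \<open>r = s\<close> the roles swap, as \<open>card B0 = r\<close>.\<close>
      moreover have "2 * card \<A> \<le> card (level H s)"
      proof (cases "r = s")
        case True
        then show ?thesis
          using card_t_intersecting_half[of t s B0 \<A>] gt[OF ts] B0' ne A meet_B0 assms(1) by simp
      next
        case False
        then show ?thesis
          using card_t_intersecting_half_lower[of t r s B0 \<A>] gt[OF ts] B B0 A meet_B0 assms(2,3)
          by auto
      qed
      ultimately show ?thesis using N_le by linarith
    qed
  qed
qed

end
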